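(* Let $\mathbb{X}$ be any continuous-time discrete self-similar Markov chain on $\mathbb{Z}_+$. Then $\mathbb{X}$ is upward skip-free.
   Context: $\mathbb{Z}_+=\{0,1,2,\dots\}$. For $\alpha\ge 0$ and a function $f$ on $\mathbb{Z}_+$, the discrete dilation operator is $\mathbb{D}_\alpha f(n)=\sum_{r=0}^n\binom{n}{r}\alpha^r(1-\alpha)^{n-r}f(r)$ (with $0^0=1$). A continuous-time Markov chain on $\mathbb{Z}_+$ with (standard) transition semigroup $(\mathbb{Q}_t)_{t\ge0}$ is discrete self-similar if for all $t\ge0$ and $\alpha\in[0,1]$, $\mathbb{Q}_t\mathbb{D}_\alpha=\mathbb{D}_\alpha\mathbb{Q}_{\alpha t}$ on the space of bounded functions on $\mathbb{Z}_+$. A continuous-time Markov chain with generator $\mathbb{G}=(\mathbb{G}(n,l))_{n,l\in\mathbb{Z}_+}$ (that is, $\mathbb{G}(n,l)=\lim_{t\downarrow0}\mathbb{Q}_t(n,l)/t$ for $l\ne n$) is upward skip-free if $\mathbb{G}(n,l)=0$ for all $n\in\mathbb{Z}_+$ and all $l\ge n+2$. *)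

theory Defs
  imports "HOL-Probability.Probability"
begin

text \<open>A transition semigroup is given by its transition probabilities
  \<open>\<Q>\<^sub>t(n,l) = pmf (Q t n) l\<close>; only times \<open>t \<ge> 0\<close> matter.
  Total mass one is no restriction in the self-similar case: the intertwining relation for
  \<open>\<alpha> = 0\<close> and \<open>f = 1\<close> already forces it.\<close>

definition standard_transition_semigroup :: "(real \<Rightarrow> nat \<Rightarrow> nat pmf) \<Rightarrow> bool" where
  "standard_transition_semigroup Q \<longleftrightarrow>
     (\<forall>n. Q 0 n = return_pmf n) \<and>
     (\<forall>s\<ge>0. \<forall>t\<ge>0. \<forall>n. Q (s + t) n = bind_pmf (Q s n) (Q t)) \<and>
     (\<forall>n. ((\<lambda>t. pmf (Q t n) n) \<longlongrightarrow> 1) (at_right 0))"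

definition semigroup_op ::
  "(real \<Rightarrow> nat \<Rightarrow> nat pmf) \<Rightarrow> real \<Rightarrow> (nat \<Rightarrow> real) \<Rightarrow> nat \<Rightarrow> real" where
  "semigroup_op Q t f n = measure_pmf.expectation (Q t n) f"

definition dilation :: "real \<Rightarrow> (nat \<Rightarrow> real) \<Rightarrow> nat \<Rightarrow> real" where
  "dilation \<alpha> f n = (\<Sum>r\<le>n. real (n choose r) * \<alpha> ^ r * (1 - \<alpha>) ^ (n - r) * f r)"

definition discrete_self_similar :: "(real \<Rightarrow> nat \<Rightarrow> nat pmf) \<Rightarrow> bool" where
  "discrete_self_similar Q \<longleftrightarrow>
     (\<forall>t\<ge>0. \<forall>\<alpha>\<in>{0..1}. \<forall>f. bounded (range f) \<longrightarrow>
        semigroup_op Q t (dilation \<alpha> f) = dilation \<alpha> (semigroup_op Q (\<alpha> * t) f))"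

text \<open>Only the off-diagonal entries are prescribed: they are finite for every standard
  semigroup, whereas the diagonal ones may be \<open>-\<infinity>\<close> for a general standard semigroup.\<close>

definition has_generator ::
  "(real \<Rightarrow> nat \<Rightarrow> nat pmf) \<Rightarrow> (nat \<Rightarrow> nat \<Rightarrow> real) \<Rightarrow> bool" where
  "has_generator Q G \<longleftrightarrow>
     (\<forall>n l. l \<noteq> n \<longrightarrow> ((\<lambda>t. pmf (Q t n) l / t) \<longlongrightarrow> G n l) (at_right 0))"

definition upward_skip_free :: "(real \<Rightarrow> nat \<Rightarrow> nat pmf) \<Rightarrow> bool" where
  "upward_skip_free Q \<longleftrightarrow> (\<exists>G. has_generator Q G \<and> (\<forall>n. \<forall>l\<ge>n + 2. G n l = 0))"

end

theory Submission
  imports Defs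
begin

text \<open>For a standard semigroup the off-diagonal rates \<open>G n l\<close> exist and are finite (the classical
  theorem of Kolmogorov, proved along skeleton chains as in Chung). Applying the intertwining
  relation with a fixed \<open>0 < \<alpha> < 1\<close> (here \<open>1/2\<close>) to the indicator function of \<open>n + 1\<close> and letting \<open>t \<rightarrow> 0\<close>, only off-diagonal rates
  appear, and Fatou's lemma gives, for \<open>l \<ge> n + 2\<close>,
  \<open>\<alpha>\<^sup>n\<^sup>+\<^sup>1 G n (n+1) + c G n l \<le> (\<Sum>r\<le>n. (n choose r) \<alpha>\<^sup>r\<^sup>+\<^sup>1 (1-\<alpha>)\<^sup>n\<^sup>-\<^sup>r G r (n+1))\<close> with \<open>c > 0\<close>.
  By induction on \<open>n\<close> the summands with \<open>r < n\<close> vanish, and the remaining one cancels the first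
  term on the left, so \<open>G n l = 0\<close>.\<close>

section \<open>Existence of the off-diagonal rates\<close>

text \<open>For fixed small \<open>t\<close>, letting \<open>h\<close> tend to 0 first gives
  \<open>(1 - e) * M \<le> F t\<close> with \<open>M\<close> the upper limit. Letting
  \<open>t\<close> tend to 0 and then \<open>e\<close> tend to 0 makes the lower limit at least
  \<open>M\<close>, so the two agree.\<close>

lemma tendsto_at_right_0_of_almost_decreasing:
  fixes F :: "real \<Rightarrow> real"
  assumes nonneg: "\<And>t. 0 < t \<Longrightarrow> 0 \<le> F t"
    and almost: "\<And>e. 0 < e \<Longrightarrow> e < 1 \<Longrightarrow>
      \<forall>\<^sub>F t in at_right 0. \<forall>\<^sub>F h in at_right 0. (1 - e) * F h \<le> F t"
  shows "\<exists>L. (F \<longlongrightarrow> L) (at_right 0)"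
proof -
  define M where "M = Limsup (at_right 0) (\<lambda>t. ereal (F t))"
  have nn: "\<forall>\<^sub>F h in at_right 0. 0 \<le> F h"
    using nonneg by (auto simp: eventually_at_right_field intro!: exI[of _ 1])
  have bound: "\<forall>\<^sub>F t in at_right 0. M \<le> ereal (F t / (1 - e))" if "0 < e" "e < 1" for e
  proof (rule eventually_mono[OF almost[OF that]])
    fix t assume "\<forall>\<^sub>F h in at_right 0. (1 - e) * F h \<le> F t"
    then have "\<forall>\<^sub>F h in at_right 0. ereal (F h) \<le> ereal (F t / (1 - e))"
      by eventually_elim (use that in \<open>simp add: field_simps\<close>)
    then show "M \<le> ereal (F t / (1 - e))"
      unfolding M_def by (rule Limsup_bounded)
  qed
  have "0 \<le> M"
  proof -
    have "0 \<le> Liminf (at_right 0) (\<lambda>t. ereal (F t))"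
      using nn by (intro Liminf_bounded) (auto elim: eventually_mono)
    also have "\<dots> \<le> M"
      unfolding M_def by (intro Liminf_le_Limsup) simp
    finally show ?thesis .
  qed
  \<comment> \<open>A single \<open>t\<close> from the bound with \<open>e = 1/2\<close> already
    shows that the upper limit is finite.\<close>
  moreover obtain t where "M \<le> ereal (F t / (1 - 1/2))"
    using eventually_happens[OF bound[of "1/2"]] by auto
  ultimately obtain L where L: "M = ereal L" "0 \<le> L"
    by (cases M) auto
  have "(F \<longlongrightarrow> L) (at_right 0)"
  proof (rule order_tendstoI)
    fix a assume "L < a"
    then have "Limsup (at_right 0) (\<lambda>t. ereal (F t)) < ereal a"
      using L by (simp add: M_def)
    then show "\<forall>\<^sub>F t in at_right 0. F t < a"
      by (drule_tac Limsup_lessD) simp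
  next
    fix a assume "a < L"
    \<comment> \<open>The second entry forces \<open>e * (L + 1) \<le> (L - a) / 2\<close>, hence
      \<open>a < (1 - e) * L\<close>. The shift to \<open>L + 1\<close> covers \<open>L = 0\<close>;
      the cap \<open>1/2\<close> keeps \<open>e < 1\<close>.\<close>
    define e where "e = min (1/2) ((L - a) / (2 * (L + 1)))"
    have e: "0 < e" "e < 1" using \<open>a < L\<close> L by (auto simp: e_def)
    have cancel: "x / (2 * p) * p = x / 2" if "0 < p" for x p :: real
      using that by simp
    have "e * (L + 1) \<le> (L - a) / 2"
    proof -
      have "e * (L + 1) \<le> (L - a) / (2 * (L + 1)) * (L + 1)"
        using L by (intro mult_right_mono) (auto simp: e_def)
      also have "\<dots> = (L - a) / 2"
        by (rule cancel) (use L in simp)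
      finally show ?thesis .
    qed
    then have "a < (1 - e) * L" using \<open>a < L\<close> e by (simp add: algebra_simps)
    from bound[OF e] show "\<forall>\<^sub>F t in at_right 0. a < F t"
    proof eventually_elim
      case (elim t)
      then have "(1 - e) * L \<le> F t" using L e by (simp add: field_simps)
      then show ?case using \<open>a < (1 - e) * L\<close> by simp
    qed
  qed
  then show ?thesis ..
qed

section \<open>Lower bounds for discrete kernels and their iterates\<close>

lemma expectation_pmf_ge_two_points:
  fixes f :: "'a \<Rightarrow> real"
  assumes "a \<noteq> b" and f: "\<And>x. 0 \<le> f x" and "integrable (measure_pmf p) f"
  shows "f a * pmf p a + f b * pmf p b \<le> measure_pmf.expectation p f"
proof -
  have int: "integrable (measure_pmf p) (indicator {c} :: 'a \<Rightarrow> real)" for c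
    by (rule measure_pmf.integrable_const_bound[where B = 1]) auto
  have "f a * pmf p a + f b * pmf p b
      = measure_pmf.expectation p (\<lambda>x. f a * indicator {a} x + f b * indicator {b} x)"
    using int by (simp add: measure_pmf_single)
  also have "\<dots> \<le> measure_pmf.expectation p f"
    using assms(1)
    by (intro integral_mono Bochner_Integration.integrable_add integrable_mult_right int assms(3))
      (auto simp: indicator_def f)
  finally show ?thesis .
qed

lemma integrable_pmf_kernel: "integrable (measure_pmf p) (\<lambda>x. pmf (K x) y)"
  by (rule measure_pmf.integrable_const_bound[where B = 1]) (auto simp: pmf_le_1)

lemma pmf_le_one_minus_pmf:
  assumes "a \<noteq> b"
  shows "pmf p a \<le> 1 - pmf p b"
proof -
  have "pmf p a + pmf p b = measure p {a, b}"
    using assms by (subst measure_measure_pmf_finite) auto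
  then show ?thesis
    using measure_pmf.prob_le_1[of p "{a, b}"] by linarith
qed

lemma pmf_bind_ge:
  "pmf p x * pmf (K x) y \<le> pmf (bind_pmf p K) y"
proof -
  have int: "integrable (measure_pmf p) (indicator {x} :: 'a \<Rightarrow> real)"
    by (rule measure_pmf.integrable_const_bound[where B = 1]) auto
  have "pmf p x * pmf (K x) y
      = measure_pmf.expectation p (\<lambda>z. indicator {x} z * pmf (K x) y)"
    using int by (simp add: measure_pmf_single)
  also have "\<dots> \<le> measure_pmf.expectation p (\<lambda>z. pmf (K z) y)"
    by (intro integral_mono integrable_mult_left int integrable_pmf_kernel)
      (auto simp: indicator_def)
  finally show ?thesis by (simp add: pmf_bind)
qed

text \<open>Powers of this kernel record first passage: after \<open>m\<close> steps the mass at
  \<open>j\<close> is the probability that the original chain has visited \<open>j\<close> by then,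
  and the mass elsewhere is that of paths avoiding \<open>j\<close>.\<close>

definition absorb :: "'a \<Rightarrow> ('a \<Rightarrow> 'a pmf) \<Rightarrow> 'a \<Rightarrow> 'a pmf" where
  "absorb j K x = (if x = j then return_pmf j else K x)"

primrec kernel_power :: "('a \<Rightarrow> 'a pmf) \<Rightarrow> nat \<Rightarrow> 'a \<Rightarrow> 'a pmf" where
  "kernel_power K 0 x = return_pmf x"
| "kernel_power K (Suc m) x = bind_pmf (K x) (kernel_power K m)"

lemma kernel_power_Suc_right:
  "kernel_power K (Suc m) x = bind_pmf (kernel_power K m x) K"
proof (induction m arbitrary: x)
  case 0
  have "kernel_power K 0 = return_pmf" by (intro ext) simp
  then show ?case by (simp add: bind_return_pmf bind_return_pmf')
next
  case (Suc m)
  have "kernel_power K (Suc m) = (\<lambda>y. bind_pmf (kernel_power K m y) K)"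
    by (intro ext Suc)
  then have "kernel_power K (Suc (Suc m)) x
      = bind_pmf (K x) (\<lambda>y. bind_pmf (kernel_power K m y) K)"
    by (simp only: kernel_power.simps(2)[of K "Suc m"])
  then show ?case by (simp add: bind_assoc_pmf)
qed

lemma kernel_power_absorb_self: "kernel_power (absorb j K) m j = return_pmf j"
  by (induction m) (auto simp: absorb_def bind_return_pmf)

text \<open>The chain is compared with its version stopped at \<open>j\<close>: before \<open>m\<close> steps that version is still
  likely to sit at \<open>i\<close>, and once it has reached \<open>j\<close> the chain itself is likely to stay there.\<close>

lemma skeleton_rate_bound:
  fixes K :: "'a \<Rightarrow> 'a pmf"
  assumes ij: "i \<noteq> j" and e: "0 \<le> e" "e \<le> 1/2"
    and stay_i: "\<And>m. m \<le> n \<Longrightarrow> 1 - e \<le> pmf (kernel_power K m i) i"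
    and stay_j: "\<And>m. m \<le> n \<Longrightarrow> 1 - e \<le> pmf (kernel_power K m j) j"
  shows "(1 - e) * (1 - 2 * e) * (real n * pmf (K i) j) \<le> pmf (kernel_power K n i) j"
proof -
  let ?R = "kernel_power (absorb j K)"
  \<comment> \<open>A path ending at \<open>i\<close> either avoids \<open>j\<close>, or hits
    \<open>j\<close> and later returns to \<open>i\<close>; the return has probability at most
    \<open>e\<close> because of \<open>stay_j\<close>.\<close>
  have A: "pmf (kernel_power K m x) i \<le> pmf (?R m x) i + e * pmf (?R m x) j" if "m \<le> n" for m x
    using that
  proof (induction m arbitrary: x)
    case 0
    then show ?case using e by simp
  next
    case (Suc m)
    show ?case
    proof (cases "x = j")
      case True
      then show ?thesis
        using pmf_le_one_minus_pmf[OF ij, of "kernel_power K (Suc m) j"] stay_j[OF Suc.prems] ij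
        unfolding True kernel_power_absorb_self by simp
    next
      case False
      have "pmf (kernel_power K (Suc m) x) i
          = measure_pmf.expectation (K x) (\<lambda>y. pmf (kernel_power K m y) i)"
        by (simp add: pmf_bind)
      also have "\<dots> \<le> measure_pmf.expectation (K x) (\<lambda>y. pmf (?R m y) i + e * pmf (?R m y) j)"
        using Suc by (intro integral_mono Bochner_Integration.integrable_add
          integrable_mult_right integrable_pmf_kernel) auto
      also have "\<dots> = pmf (?R (Suc m) x) i + e * pmf (?R (Suc m) x) j"
        using False by (simp add: pmf_bind absorb_def integrable_pmf_kernel)
      finally show ?thesis .
    qed
  qed
  have B: "(1 - e) * pmf (?R m x) j \<le> pmf (kernel_power K m x) j" if "m \<le> n" for m x
    using that
  proof (induction m arbitrary: x)
    case 0
    then show ?case using e by (simp add: mult_left_le_one_le)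
  next
    case (Suc m)
    show ?case
    proof (cases "x = j")
      case True
      then show ?thesis
        using stay_j[OF Suc.prems] unfolding True kernel_power_absorb_self by simp
    next
      case False
      have "(1 - e) * pmf (?R (Suc m) x) j
          = measure_pmf.expectation (K x) (\<lambda>y. (1 - e) * pmf (?R m y) j)"
        using False by (simp add: pmf_bind absorb_def)
      also have "\<dots> \<le> measure_pmf.expectation (K x) (\<lambda>y. pmf (kernel_power K m y) j)"
        using Suc by (intro integral_mono integrable_mult_right integrable_pmf_kernel) auto
      finally show ?thesis by (simp add: pmf_bind)
    qed
  qed
  \<comment> \<open>By \<open>A\<close> and \<open>stay_i\<close> the stopped chain is at
    \<open>i\<close> with probability at least \<open>1 - 2 * e\<close> at each time. So every step
    moves at least \<open>(1 - 2 * e) * pmf (K i) j\<close> of new mass into \<open>j\<close>, where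
    it is trapped and adds up.\<close>
  have C: "(1 - 2 * e) * (real m * pmf (K i) j) \<le> pmf (?R m i) j" if "m \<le> n" for m
    using that
  proof (induction m)
    case 0
    then show ?case by simp
  next
    case (Suc m)
    have "e * pmf (?R m i) j \<le> e"
      using e by (simp add: mult_left_le pmf_le_1)
    then have "1 - 2 * e \<le> pmf (?R m i) i"
      using A[of m i] stay_i[of m] Suc.prems by simp
    then have "(1 - 2 * e) * pmf (K i) j \<le> pmf (?R m i) i * pmf (K i) j"
      by (intro mult_right_mono) auto
    then have "(1 - 2 * e) * (real (Suc m) * pmf (K i) j)
        \<le> pmf (?R m i) j + pmf (?R m i) i * pmf (K i) j"
      using Suc by (simp add: algebra_simps)
    also have "\<dots> = pmf (absorb j K j) j * pmf (?R m i) j + pmf (absorb j K i) j * pmf (?R m i) i"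
      using ij by (simp add: absorb_def)
    also have "\<dots> \<le> pmf (?R (Suc m) i) j"
      unfolding kernel_power_Suc_right pmf_bind using ij
      by (intro expectation_pmf_ge_two_points integrable_pmf_kernel) auto
    finally show ?case .
  qed
  have "(1 - e) * ((1 - 2 * e) * (real n * pmf (K i) j)) \<le> (1 - e) * pmf (?R n i) j"
    using C[of n] e by (intro mult_left_mono) auto
  also have "\<dots> \<le> pmf (kernel_power K n i) j" by (rule B) simp
  finally show ?thesis by (simp add: mult.assoc)
qed

section \<open>Skeletons of a standard semigroup and small-time rates\<close>

lemma semigroup_add:
  assumes "standard_transition_semigroup Q" "0 \<le> s" "0 \<le> t"
  shows "Q (s + t) n = bind_pmf (Q s n) (Q t)"
  using assms unfolding standard_transition_semigroup_def by blast

lemma semigroup_kernel_power: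
  assumes Q: "standard_transition_semigroup Q" and h: "0 \<le> h"
  shows "kernel_power (Q h) m n = Q (real m * h) n"
proof (induction m arbitrary: n)
  case 0
  then show ?case using Q by (simp add: standard_transition_semigroup_def)
next
  case (Suc m)
  have "Q (h + real m * h) n = bind_pmf (Q h n) (Q (real m * h))"
    using h by (intro semigroup_add[OF Q]) auto
  moreover have "kernel_power (Q h) m = Q (real m * h)"
    using Suc by (intro ext)
  ultimately show ?case by (simp add: algebra_simps)
qed

lemma standard_stay_prob:
  assumes "standard_transition_semigroup Q" and "0 < e"
  shows "\<exists>d>0. \<forall>s. 0 \<le> s \<longrightarrow> s \<le> d \<longrightarrow> 1 - e \<le> pmf (Q s n) n"
proof -
  have "((\<lambda>t. pmf (Q t n) n) \<longlongrightarrow> 1) (at_right 0)" and Q0: "Q 0 n = return_pmf n"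
    using assms by (auto simp: standard_transition_semigroup_def)
  then have "\<forall>\<^sub>F s in at_right 0. 1 - e < pmf (Q s n) n"
    using \<open>0 < e\<close> by (intro order_tendstoD) auto
  then obtain b where b: "0 < b" "\<And>s. 0 < s \<Longrightarrow> s < b \<Longrightarrow> 1 - e < pmf (Q s n) n"
    by (auto simp: eventually_at_right_field)
  have "1 - e \<le> pmf (Q s n) n" if "0 \<le> s" "s \<le> b / 2" for s
    using b that Q0 \<open>0 < e\<close> by (cases "s = 0") (auto intro: less_imp_le)
  then show ?thesis using b by (intro exI[of _ "b / 2"]) auto
qed

text \<open>If \<open>h\<close> is small compared with \<open>t\<close>, about \<open>t / h\<close>
  steps of the \<open>h\<close>-skeleton fit into time \<open>t\<close>, each offering a jump of
  probability \<open>pmf (Q h i) j\<close>. The quotient at \<open>t\<close> is therefore nearly at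
  least the one at \<open>h\<close>.\<close>

theorem standard_semigroup_rate_exists:
  assumes Q: "standard_transition_semigroup Q" and ij: "i \<noteq> j"
  shows "\<exists>L. ((\<lambda>t. pmf (Q t i) j / t) \<longlongrightarrow> L) (at_right 0)"
proof (rule tendsto_at_right_0_of_almost_decreasing)
  fix e :: real assume e: "0 < e" "e < 1"
  \<comment> \<open>The losses add up to \<open>5 * d\<close>: \<open>d\<close> and
    \<open>2 * d\<close> from the skeleton bound, \<open>d\<close> for staying at \<open>j\<close>
    in the leftover time, and \<open>d\<close> for rounding \<open>t / h\<close>.\<close>
  define d where "d = e / 5"
  have d: "0 < d" "d \<le> 1/5" using e by (auto simp: d_def)
  obtain b1 where b1: "0 < b1" "\<And>s. 0 \<le> s \<Longrightarrow> s \<le> b1 \<Longrightarrow> 1 - d \<le> pmf (Q s i) i"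
    using standard_stay_prob[OF Q d(1), of i] by auto
  obtain b2 where b2: "0 < b2" "\<And>s. 0 \<le> s \<Longrightarrow> s \<le> b2 \<Longrightarrow> 1 - d \<le> pmf (Q s j) j"
    using standard_stay_prob[OF Q d(1), of j] by auto
  have main: "(1 - e) * (pmf (Q h i) j / h) \<le> pmf (Q t i) j / t"
    if t: "0 < t" "t < min b1 b2" and h: "0 < h" "h < d * t" for t h
  proof -
    let ?g = "\<lambda>t. pmf (Q t i) j"
    define n where "n = nat \<lfloor>t / h\<rfloor>"
    have n: "real n \<le> t / h" "t / h - 1 \<le> real n"
      using t h by (auto simp: n_def)
    have nh: "real n * h \<le> t" using n h by (simp add: field_simps)
    have stay: "real m * h \<le> t" if "m \<le> n" for m
      using that nh h by (meson mult_right_mono of_nat_mono order_trans less_imp_le)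
    have 1: "(1 - d) * (1 - 2 * d) * (real n * ?g h) \<le> ?g (real n * h)"
      unfolding semigroup_kernel_power[OF Q less_imp_le[OF h(1)], symmetric]
    proof (rule order_trans[OF _ skeleton_rate_bound[OF ij]])
      fix m assume "m \<le> n"
      then have "real m * h \<le> b1" "real m * h \<le> b2" "0 \<le> real m * h"
        using stay[of m] t h by auto
      then show "1 - d \<le> pmf (kernel_power (Q h) m i) i" "1 - d \<le> pmf (kernel_power (Q h) m j) j"
        unfolding semigroup_kernel_power[OF Q less_imp_le[OF h(1)]] by (auto intro: b1 b2)
    qed (use d in auto)
    have "Q (real n * h + (t - real n * h)) i = bind_pmf (Q (real n * h) i) (Q (t - real n * h))"
      using nh h by (intro semigroup_add[OF Q]) auto
    then have "?g (real n * h) * pmf (Q (t - real n * h) j) j \<le> ?g t"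
      using pmf_bind_ge[of "Q (real n * h) i" j "Q (t - real n * h)" j] by simp
    moreover have "?g (real n * h) * (1 - d) \<le> ?g (real n * h) * pmf (Q (t - real n * h) j) j"
    proof (intro mult_left_mono b2(2))
      have "0 \<le> real n * h" using h by simp
      then show "0 \<le> t - real n * h" "t - real n * h \<le> b2" using nh t by linarith+
    qed simp
    moreover have "(1 - d) * (1 - 2 * d) * (real n * ?g h) * (1 - d) \<le> ?g (real n * h) * (1 - d)"
      using 1 d by (intro mult_right_mono) auto
    ultimately have 2: "(1 - d) * (1 - 2 * d) * (1 - d) * (real n * ?g h) \<le> ?g t"
      by (simp add: mult_ac)
    \<comment> \<open>Rounding costs at most one step, and \<open>h < d * t\<close> makes one step
      at most the fraction \<open>d\<close> of \<open>t / h\<close>.\<close>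
    have "t * (1 - d) / h \<le> real n"
    proof -
      have "1 \<le> d * t / h" using h by simp
      then have "t / h - d * t / h \<le> t / h - 1" by (rule diff_left_mono)
      also have "\<dots> \<le> real n" by (rule n)
      finally show ?thesis
        by (simp add: right_diff_distrib diff_divide_distrib mult.commute)
    qed
    then have "(1 - d) * (1 - 2 * d) * (1 - d) * (t * (1 - d) / h * ?g h)
        \<le> (1 - d) * (1 - 2 * d) * (1 - d) * (real n * ?g h)"
      using d by (intro mult_left_mono mult_right_mono) auto
    with 2 have "((1 - d) * (1 - 2 * d) * (1 - d) * (1 - d)) * (?g h / h) * t \<le> ?g t"
      by (simp add: mult_ac)
    then have 3: "((1 - d) * (1 - 2 * d) * (1 - d) * (1 - d)) * (?g h / h) \<le> ?g t / t"
      using t(1) by (simp only: pos_le_divide_eq)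
    have "1 - e \<le> (1 - d) * (1 - 2 * d) * (1 - d) * (1 - d)"
    proof -
      have *: "1 - (x + y) \<le> (1 - x) * (1 - y)" if "0 \<le> x" "0 \<le> y" for x y :: real
        using mult_nonneg_nonneg[OF that] by (simp add: algebra_simps)
      have "1 - 3 * d \<le> (1 - d) * (1 - 2 * d)" using *[of d "2 * d"] d by simp
      then have "(1 - 3 * d) * (1 - d) \<le> (1 - d) * (1 - 2 * d) * (1 - d)"
        using d by (intro mult_right_mono) auto
      then have "1 - 4 * d \<le> (1 - d) * (1 - 2 * d) * (1 - d)" using *[of "3 * d" d] d by linarith
      then have "(1 - 4 * d) * (1 - d) \<le> (1 - d) * (1 - 2 * d) * (1 - d) * (1 - d)"
        using d by (intro mult_right_mono) auto
      moreover have "1 - e = 1 - (4 * d + d)" by (simp add: d_def)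
      ultimately show ?thesis using *[of "4 * d" d] d by linarith
    qed
    then have "(1 - e) * (?g h / h) \<le> ((1 - d) * (1 - 2 * d) * (1 - d) * (1 - d)) * (?g h / h)"
      using h by (intro mult_right_mono) auto
    with 3 show ?thesis by linarith
  qed
  have "\<forall>\<^sub>F h in at_right 0. (1 - e) * (pmf (Q h i) j / h) \<le> pmf (Q t i) j / t"
    if "0 < t" "t < min b1 b2" for t
    using main[OF that] that d
    by (auto simp: eventually_at_right_field intro!: exI[of _ "d * t"])
  moreover have "\<forall>\<^sub>F t in at_right 0. t \<in> {0<..<min b1 b2}"
    using b1(1) b2(1) by (intro eventually_at_right_real) auto
  ultimately show "\<forall>\<^sub>F t in at_right 0. \<forall>\<^sub>F h in at_right 0.
      (1 - e) * (pmf (Q h i) j / h) \<le> pmf (Q t i) j / t"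
    by (auto elim!: eventually_mono)
qed auto

section \<open>Upward jumps under self-similarity\<close>

text \<open>This is the binomial law with parameters \<open>n\<close> and \<alpha>, evaluated at
  \<open>k\<close>; for \<alpha> strictly between 0 and 1 it is positive for all
  \<open>n \<ge> k\<close>, so a jump to \<open>l\<close> gets positive weight.\<close>

lemma dilation_indicator:
  "dilation \<alpha> (indicator {k}) n
    = (if k \<le> n then real (n choose k) * \<alpha> ^ k * (1 - \<alpha>) ^ (n - k) else 0)"
proof -
  have "dilation \<alpha> (indicator {k}) n
      = (\<Sum>r\<le>n. if k = r then real (n choose r) * \<alpha> ^ r * (1 - \<alpha>) ^ (n - r) else 0)"
    unfolding dilation_def by (intro sum.cong) (auto simp: indicator_def)
  then show ?thesis by (simp add: sum.delta)
qed

lemma dilation_nonneg: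
  assumes "0 \<le> \<alpha>" "\<alpha> \<le> 1" "\<And>n. 0 \<le> f n"
  shows "0 \<le> dilation \<alpha> f n"
  unfolding dilation_def using assms by (intro sum_nonneg) auto

lemma dilation_le_1:
  assumes "0 \<le> \<alpha>" "\<alpha> \<le> 1" "\<And>n. f n \<le> 1"
  shows "dilation \<alpha> f n \<le> 1"
proof -
  have "dilation \<alpha> f n \<le> (\<Sum>r\<le>n. real (n choose r) * \<alpha> ^ r * (1 - \<alpha>) ^ (n - r))"
    unfolding dilation_def using assms by (intro sum_mono mult_left_le) auto
  also have "\<dots> = (\<alpha> + (1 - \<alpha>)) ^ n"
    by (simp only: binomial_ring)
  finally show ?thesis by simp
qed

lemma self_similar_generator_skip_free:
  assumes S: "discrete_self_similar Q" and G: "has_generator Q G"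
  shows "n + 2 \<le> l \<Longrightarrow> G n l = 0"
proof (induction n arbitrary: l rule: less_induct)
  case (less n)
  define k where "k = n + 1"
  define c :: "nat \<Rightarrow> real" where "c = dilation (1/2) (indicator {k})"
  \<comment> \<open>The final division by 2 comes from the time scaling: dividing by
    \<open>t\<close> instead of \<open>t / 2\<close> costs the factor \<open>1/2\<close>.\<close>
  define w where "w r = real (n choose r) * (1/2) ^ r * (1 - 1/2) ^ (n - r) / 2" for r
  have lim: "((\<lambda>t. pmf (Q t m) l / t) \<longlongrightarrow> G m l) (at_right 0)" if "l \<noteq> m" for m l
    using G that by (simp add: has_generator_def)
  have ineq: "c k * (pmf (Q t n) k / t) + c l * (pmf (Q t n) l / t)
      \<le> (\<Sum>r\<le>n. w r * (pmf (Q (t / 2) r) k / (t / 2)))" if t: "0 < t" for t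
  proof -
    have "bounded (range (indicator {k} :: nat \<Rightarrow> real))"
      by (rule boundedI[of _ 1]) auto
    then have eq: "semigroup_op Q t c
        = dilation (1/2) (semigroup_op Q (1/2 * t) (indicator {k}))"
      using S t unfolding discrete_self_similar_def c_def by simp
    \<comment> \<open>Keeping only the targets \<open>k\<close> and \<open>l\<close> leaves terms
      whose limits exist, which does the work of Fatou's lemma.\<close>
    have "c k * pmf (Q t n) k + c l * pmf (Q t n) l \<le> semigroup_op Q t c n"
      unfolding semigroup_op_def
    proof (rule expectation_pmf_ge_two_points)
      show "k \<noteq> l" using less.prems by (simp add: k_def)
      show c0: "0 \<le> c x" for x
        unfolding c_def by (rule dilation_nonneg) auto
      have "c x \<le> 1" for x
        unfolding c_def by (rule dilation_le_1) auto
      with c0 show "integrable (measure_pmf (Q t n)) c"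
        by (intro measure_pmf.integrable_const_bound[where B = 1]) auto
    qed
    also have "\<dots> = (\<Sum>r\<le>n. 2 * w r * pmf (Q (t / 2) r) k)"
      unfolding eq by (simp add: dilation_def semigroup_op_def measure_pmf_single w_def)
    finally have "(c k * pmf (Q t n) k + c l * pmf (Q t n) l) / t
        \<le> (\<Sum>r\<le>n. 2 * w r * pmf (Q (t / 2) r) k) / t"
      using t by (intro divide_right_mono) auto
    then show ?thesis
      by (simp add: sum_divide_distrib add_divide_distrib mult_ac)
  qed
  have half: "filterlim (\<lambda>t::real. t / 2) (at_right 0) (at_right 0)"
    by (auto simp: filterlim_at eventually_at_right_field intro!: tendsto_eq_intros exI[of _ 1])
  have "c k * G n k + c l * G n l \<le> (\<Sum>r\<le>n. w r * G r k)"
  proof (rule tendsto_le)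
    show "((\<lambda>t. c k * (pmf (Q t n) k / t) + c l * (pmf (Q t n) l / t))
        \<longlongrightarrow> c k * G n k + c l * G n l) (at_right 0)"
      using less.prems by (intro tendsto_add tendsto_mult_left lim) (auto simp: k_def)
    show "((\<lambda>t. \<Sum>r\<le>n. w r * (pmf (Q (t / 2) r) k / (t / 2)))
        \<longlongrightarrow> (\<Sum>r\<le>n. w r * G r k)) (at_right 0)"
      by (intro tendsto_sum tendsto_mult_left filterlim_compose[OF lim half]) (auto simp: k_def)
    show "\<forall>\<^sub>F t in at_right 0. c k * (pmf (Q t n) k / t) + c l * (pmf (Q t n) l / t)
        \<le> (\<Sum>r\<le>n. w r * (pmf (Q (t / 2) r) k / (t / 2)))"
      using ineq by (auto simp: eventually_at_right_field intro!: exI[of _ 1])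
  qed simp
  \<comment> \<open>For \<open>r < n\<close> the target \<open>k = n + 1\<close> is at least
    \<open>r + 2\<close>, so the induction hypothesis applies.\<close>
  also have "(\<Sum>r\<le>n. w r * G r k) = (\<Sum>r\<in>{n}. w r * G r k)"
    using less.IH by (intro sum.mono_neutral_right) (auto simp: k_def)
  \<comment> \<open>Both weights are \<open>(1/2) ^ (n + 1)\<close>: the binomial weight at
    \<open>r = n\<close> lacks one factor \<open>1/2\<close>, and the time scaling supplies
    it.\<close>
  also have "\<dots> = c k * G n k"
    by (simp add: w_def c_def dilation_indicator k_def)
  finally have "c l * G n l \<le> 0" by simp
  moreover have "0 < c l"
    using less.prems by (simp add: c_def dilation_indicator k_def)
  moreover have "0 \<le> G n l"
    using less.prems
    by (intro tendsto_lowerbound[OF lim]) (auto simp: eventually_at_right_field intro!: exI[of _ 1])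
  ultimately show ?case
    by (simp add: mult_le_0_iff)
qed

theorem theorem2p5:
  fixes Q :: "real \<Rightarrow> nat \<Rightarrow> nat pmf"
  assumes "standard_transition_semigroup Q"
    and "discrete_self_similar Q"
  shows "upward_skip_free Q"
proof -
  \<comment> \<open>With \<open>l \<noteq> n\<close> kept under the existential, choice yields a
    total \<open>G\<close> whose diagonal is arbitrary.\<close>
  have "\<forall>n l. \<exists>L. l \<noteq> n \<longrightarrow> ((\<lambda>t. pmf (Q t n) l / t) \<longlongrightarrow> L) (at_right 0)"
    using standard_semigroup_rate_exists[OF assms(1)] by metis
  then obtain G where "has_generator Q G"
    unfolding has_generator_def by metis
  with self_similar_generator_skip_free[OF assms(2)] show ?thesis
    unfolding upward_skip_free_def by blast
qed

end
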